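(* Let $n$ be a positive integer, $\Lambda$ a finitely generated abelian group and $R=\mathbb Z_n[\Lambda]$. If $\mathfrak a\subset R$ is an ideal, then $\dim(R/\mathfrak a)=0$ if and only if there exists a subgroup $\Gamma\subset\Lambda$ of finite index such that $x^\gamma-1\in\mathfrak a$ for every $\gamma\in\Gamma$.
   Context: $\mathbb Z_n=\mathbb Z/n\mathbb Z$; $\mathbb Z_n[\Lambda]$ is the group ring of $\Lambda$ over $\mathbb Z_n$, and $x^\lambda$ denotes the element of the group ring corresponding to $\lambda\in\Lambda$. $\dim$ denotes Krull dimension; by convention the zero module has Krull dimension $-\infty$.
   Formalization: The right-hand side also requires that the ideal 𝔞 be proper: for 𝔞 = R the quotient is zero and has dimension −∞, not 0, while Γ = Λ satisfies the stated condition, so the equivalence as written fails there. *)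

theory Defs
  imports "HOL-Library.Extended_Real" "HOL-Algebra.Algebra"
begin

text \<open>
  An element of the group ring of \<open>G\<close> over \<open>K\<close> is its family of coefficients: a finitely supported
  function, which is \<open>\<zero>\<close> outside \<open>carrier G\<close>.
\<close>

definition group_ring ::
    "('k, 'a) ring_scheme \<Rightarrow> ('g, 'b) monoid_scheme \<Rightarrow> ('g \<Rightarrow> 'k) ring" where
  "group_ring K G =
     \<lparr>carrier = {f. range f \<subseteq> carrier K \<and> finite {g. f g \<noteq> \<zero>\<^bsub>K\<^esub>} \<and> {g. f g \<noteq> \<zero>\<^bsub>K\<^esub>} \<subseteq> carrier G},
      monoid.mult = (\<lambda>f h g. finsum K (\<lambda>(s, t). f s \<otimes>\<^bsub>K\<^esub> h t)
        {(s, t). f s \<noteq> \<zero>\<^bsub>K\<^esub> \<and> h t \<noteq> \<zero>\<^bsub>K\<^esub> \<and> s \<otimes>\<^bsub>G\<^esub> t = g}),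
      one = (\<lambda>g. if g = \<one>\<^bsub>G\<^esub> then \<one>\<^bsub>K\<^esub> else \<zero>\<^bsub>K\<^esub>),
      ring.zero = (\<lambda>g. \<zero>\<^bsub>K\<^esub>),
      add = (\<lambda>f h g. f g \<oplus>\<^bsub>K\<^esub> h g)\<rparr>"

text \<open>The basis element \<open>x\<^sup>l\<close> of the group ring, for \<open>l \<in> carrier G\<close>.\<close>

definition group_ring_monom :: "('k, 'a) ring_scheme \<Rightarrow> 'g \<Rightarrow> 'g \<Rightarrow> 'k" where
  "group_ring_monom K l = (\<lambda>g. if g = l then \<one>\<^bsub>K\<^esub> else \<zero>\<^bsub>K\<^esub>)"

definition finitely_generated_group :: "('g, 'b) monoid_scheme \<Rightarrow> bool" where
  "finitely_generated_group G \<longleftrightarrow> (\<exists>S. finite S \<and> S \<subseteq> carrier G \<and> generate G S = carrier G)"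

text \<open>
  The zero ring has no prime ideals, so its dimension is \<open>Sup {} = -\<infinity>\<close>.
\<close>

definition krull_dim :: "('k, 'a) ring_scheme \<Rightarrow> ereal" where
  "krull_dim R = Sup {ereal (real m) | m.
     \<exists>P. (\<forall>i\<le>m. primeideal (P i) R) \<and> (\<forall>i<m. P i \<subset> P (Suc i))}"

end

theory Submission
  imports Defs
begin

text \<open>
  Let \<open>S = R/\<aa>\<close> and let \<open>\<phi>\<close> map \<open>\<Lambda>\<close> to the units of \<open>S\<close>. A suitable \<open>\<Gamma>\<close> exists iff
  \<open>\<phi>(\<Lambda>)\<close> is finite. If \<open>\<phi>(\<Lambda>)\<close> is finite then so is \<open>S\<close>, hence all its primes are maximal.
  Conversely let \<open>dim S = 0\<close> and suppose that a unit \<open>u\<close> has infinite order. With \<open>v = u\<^sup>k\<^sup>l\<close>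
  and \<open>n = 0\<close> in \<open>S\<close> one has \<open>v\<^sup>n - 1 = (v - 1)\<^sup>2 w\<close>, a multiple of \<open>(u\<^sup>k - 1)(u\<^sup>l - 1)\<close>;
  so some prime \<open>P\<close> contains no \<open>u\<^sup>k - 1\<close> with \<open>k > 0\<close>. But \<open>P\<close> is maximal, and \<open>S/P\<close> is a field
  that is finitely generated as a ring, hence finite by Zariski's lemma: a contradiction.
  Therefore \<open>\<phi>(\<Lambda>)\<close> is a finitely generated torsion abelian group, so it is finite.
\<close>

subsection \<open>Prime ideals and dimension zero\<close>

text \<open>By commutativity, each element generated by \<open>insert s S\<close> is a product of a
  member of the finite cyclic group of \<open>s\<close> and a member of the finite group from the
  induction hypothesis. The lemma serves unit groups and additive groups alike.\<close>

lemma (in comm_group) finite_generate: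
  assumes "finite S" "S \<subseteq> carrier G" "\<And>s. s \<in> S \<Longrightarrow> \<exists>k::nat. 0 < k \<and> s [^] k = \<one>"
  shows "finite (generate G S)"
  using assms
proof (induction S)
  case empty
  have "generate G {} \<subseteq> {\<one>}"
  proof
    fix x assume "x \<in> generate G {}"
    then show "x \<in> {\<one>}" by induction auto
  qed
  then show ?case by (rule finite_subset) simp
next
  case (insert s S)
  let ?A = "generate G {s}" and ?B = "generate G S"
  have s: "s \<in> carrier G" and S: "S \<subseteq> carrier G" using insert by auto
  have "ord s \<noteq> 0"
    using insert.prems(2)[of s] ord_eq_0[OF s] by auto
  then have "finite ?A"
    using finite_cyclic_subgroup_order[OF s] carrier_subgroup_generated[of G "{s}"] s by auto
  moreover have "finite ?B" using insert by blast
  ultimately have "finite ((\<lambda>(a, b). a \<otimes> b) ` (?A \<times> ?B))" by simp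
  moreover have "generate G (insert s S) \<subseteq> (\<lambda>(a, b). a \<otimes> b) ` (?A \<times> ?B)"
  proof
    note cA = generate_in_carrier[of "{s}"] and cB = generate_in_carrier[of S]
    fix x assume "x \<in> generate G (insert s S)"
    then have "\<exists>a\<in>?A. \<exists>b\<in>?B. x = a \<otimes> b"
    proof induction
      case one
      show ?case by (metis generate.one l_one one_closed)
    next
      case (incl h)
      then show ?case using s S generate.one[of G] generate.incl[of h]
        by (metis insertE insertI1 l_one r_one subsetD)
    next
      case (inv h)
      then show ?case using s S generate.one[of G] generate.inv[of h]
        by (metis insertE insertI1 l_one r_one subsetD inv_closed)
    next
      case (eng x y)
      then obtain a b c d where *: "a \<in> ?A" "b \<in> ?B" "x = a \<otimes> b" "c \<in> ?A" "d \<in> ?B" "y = c \<otimes> d"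
        by blast
      then have "x \<otimes> y = (a \<otimes> c) \<otimes> (b \<otimes> d)"
        using cA cB s S by (simp add: m_ac)
      then show ?case using * generate.eng[of _ G] by blast
    qed
    then show "x \<in> (\<lambda>(a, b). a \<otimes> b) ` (?A \<times> ?B)" by auto
  qed
  ultimately show ?case by (rule finite_subset[rotated])
qed

text \<open>An ideal maximal among those containing \<open>I\<close> and avoiding \<open>M\<close>
  is prime. Closure of \<open>M\<close> under products is weakened to "some multiple of
  \<open>a b\<close> lies in \<open>M\<close>"; the differences \<open>u^k - 1\<close> satisfy only
  this weaker form.\<close>

lemma (in cring) exists_prime_avoiding:
  assumes I: "ideal I R" "I \<inter> M = {}"
    and M: "M \<subseteq> carrier R" "M \<noteq> {}" "\<And>a b. a \<in> M \<Longrightarrow> b \<in> M \<Longrightarrow> \<exists>c\<in>carrier R. a \<otimes> b \<otimes> c \<in> M"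
  obtains P where "primeideal P R" "I \<subseteq> P" "P \<inter> M = {}"
proof -
  let ?F = "{J. ideal J R \<and> I \<subseteq> J \<and> J \<inter> M = {}}"
  have "\<exists>P\<in>?F. \<forall>J\<in>?F. P \<subseteq> J \<longrightarrow> J = P"
  proof (rule subset_Zorn_nonempty)
    show "?F \<noteq> {}" using I by blast
    fix C assume C: "C \<noteq> {}" "subset.chain ?F C"
    then have "subset.chain {J. ideal J R} C" by (auto simp: pred_on.chain_def)
    from chain_Union_is_ideal[OF this] C have "ideal (\<Union>C) R" by simp
    with C show "\<Union>C \<in> ?F" by (auto simp: pred_on.chain_def)
  qed
  then obtain P where P: "ideal P R" "I \<subseteq> P" "P \<inter> M = {}"
    and max: "\<And>J. ideal J R \<Longrightarrow> J \<inter> M = {} \<Longrightarrow> P \<subseteq> J \<Longrightarrow> J = P"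
    by (auto dest: order_trans)
  interpret P: ideal P R by fact
  \<comment> \<open>By maximality the strictly larger ideal \<open>P + (a)\<close> must meet
    \<open>M\<close>.\<close>
  have meets: "\<exists>p\<in>P. \<exists>r\<in>carrier R. p \<oplus> r \<otimes> a \<in> M" if a: "a \<in> carrier R" "a \<notin> P" for a
  proof (rule ccontr)
    assume none: "\<not> ?thesis"
    let ?J = "P <+>\<^bsub>R\<^esub> PIdl a"
    have mem: "x \<in> ?J \<longleftrightarrow> (\<exists>p\<in>P. \<exists>r\<in>carrier R. x = p \<oplus> r \<otimes> a)" for x
      by (auto simp: set_add_def' cgenideal_def)
    have "ideal ?J R" by (intro add_ideals P cgenideal_ideal a)
    moreover have "?J \<inter> M = {}" using none mem by auto
    moreover have "P \<subseteq> ?J"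
    proof
      fix p assume "p \<in> P"
      moreover have "p = p \<oplus> \<zero> \<otimes> a" using a \<open>p \<in> P\<close> P.Icarr by simp
      ultimately show "p \<in> ?J" unfolding mem by blast
    qed
    moreover have "a \<in> ?J"
    proof -
      have "a = \<zero> \<oplus> \<one> \<otimes> a" using a by simp
      then show ?thesis unfolding mem using P.zero_closed by blast
    qed
    ultimately show False using max a by blast
  qed
  have "primeideal P R"
  proof (rule primeidealI[OF P(1) is_cring])
    show "carrier R \<noteq> P" using M P(3) by blast
    fix a b assume ab: "a \<in> carrier R" "b \<in> carrier R" "a \<otimes> b \<in> P"
    show "a \<in> P \<or> b \<in> P"
    proof (rule ccontr)
      assume "\<not> ?thesis"
      then obtain p r q s where *: "p \<in> P" "r \<in> carrier R" "p \<oplus> r \<otimes> a \<in> M"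
        "q \<in> P" "s \<in> carrier R" "q \<oplus> s \<otimes> b \<in> M"
        using meets[of a] meets[of b] ab by blast
      then obtain c where c: "c \<in> carrier R" "(p \<oplus> r \<otimes> a) \<otimes> (q \<oplus> s \<otimes> b) \<otimes> c \<in> M"
        using M(3) by blast
      have pq: "p \<in> carrier R" "q \<in> carrier R" using * P.Icarr by auto
      \<comment> \<open>Every summand on the right has a factor \<open>p\<close>, \<open>q\<close>
        or \<open>a b\<close>, all in \<open>P\<close>.\<close>
      have "(p \<oplus> r \<otimes> a) \<otimes> (q \<oplus> s \<otimes> b)
          = p \<otimes> (q \<oplus> s \<otimes> b) \<oplus> (q \<otimes> (r \<otimes> a) \<oplus> (a \<otimes> b) \<otimes> (r \<otimes> s))"
        using pq * ab c by (simp add: l_distr r_distr m_ac a_ac)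
      also have "\<dots> \<in> P"
        using pq * ab c
        by (intro P.a_closed P.I_r_closed[OF *(1)] P.I_r_closed[OF *(4)] P.I_r_closed[OF ab(3)]) auto
      finally have "(p \<oplus> r \<otimes> a) \<otimes> (q \<oplus> s \<otimes> b) \<otimes> c \<in> P"
        by (rule P.I_r_closed[OF _ c(1)])
      then show False using c P(3) by blast
    qed
  qed
  with P that show ?thesis by blast
qed

lemma krull_dim_ge:
  assumes "\<And>i. i \<le> m \<Longrightarrow> primeideal (P i) R" "\<And>i. i < m \<Longrightarrow> P i \<subset> P (Suc i)"
  shows "ereal (real m) \<le> krull_dim R"
  unfolding krull_dim_def using assms by (intro Sup_upper) blast

text \<open>A nonzero ring has a prime, which gives the lower bound 0. If a prime lies strictly
  inside a proper ideal, a prime above that ideal yields a chain of length one. The zero ring is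
  excluded because its dimension is the supremum of the empty set.\<close>

lemma krull_dim_eq_zero_iff:
  fixes R (structure)
  assumes "cring R"
  shows "krull_dim R = 0 \<longleftrightarrow> \<one> \<noteq> \<zero> \<and> (\<forall>P. primeideal P R \<longrightarrow> maximalideal P R)"
proof -
  interpret cring R by fact
  have above: "\<exists>P. primeideal P R \<and> I \<subseteq> P" if I: "ideal I R" "I \<noteq> carrier R" for I
  proof -
    have "\<one> \<notin> I" using ideal.one_imp_carrier[OF I(1)] I(2) by blast
    then obtain P where "primeideal P R" "I \<subseteq> P" "P \<inter> {\<one>} = {}"
      by (rule_tac exists_prime_avoiding[OF I(1), of "{\<one>}"]) auto
    then show ?thesis by blast
  qed
  show ?thesis
  proof
    assume dim: "krull_dim R = 0"
    have "\<one> \<noteq> \<zero>"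
    proof
      assume "\<one> = \<zero>"
      then have "\<not> primeideal P R" for P
        using one_zeroD primeideal.I_notcarr[of P R] primeideal.axioms(1)[of P R]
          additive_subgroup.zero_closed[of P R] ideal.axioms(1)[of P R] additive_subgroup.a_subset[of P R]
        by (metis subset_singletonD empty_iff)
      then have "krull_dim R = Sup {}"
        unfolding krull_dim_def by (intro arg_cong[where f = Sup]) auto
      with dim show False by (simp add: bot_ereal_def)
    qed
    moreover have "maximalideal P R" if P: "primeideal P R" for P
    proof (rule maximalidealI)
      interpret primeideal P R by fact
      show "ideal P R" by (rule is_ideal)
      show "carrier R \<noteq> P" by (rule I_notcarr)
      fix J assume J: "ideal J R" "P \<subseteq> J" "J \<subseteq> carrier R"
      show "J = P \<or> J = carrier R"
      proof (rule ccontr)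
        assume neg: "\<not> ?thesis"
        with above J obtain Q where Q: "primeideal Q R" "J \<subseteq> Q" by blast
        then have "P \<subset> Q" using neg J by blast
        then have "ereal (real 1) \<le> krull_dim R"
          using P Q by (intro krull_dim_ge[where P = "\<lambda>i. if i = 0 then P else Q"]) auto
        then show False using dim by simp
      qed
    qed
    ultimately show "\<one> \<noteq> \<zero> \<and> (\<forall>P. primeideal P R \<longrightarrow> maximalideal P R)" by blast
  next
    assume *: "\<one> \<noteq> \<zero> \<and> (\<forall>P. primeideal P R \<longrightarrow> maximalideal P R)"
    then have "{\<zero>} \<noteq> carrier R" using one_closed by blast
    then obtain Q where Q: "primeideal Q R" using above zeroideal by blast
    show "krull_dim R = 0"
    proof (rule antisym)
      show "0 \<le> krull_dim R" using krull_dim_ge[of 0 "\<lambda>_. Q"] Q by (simp add: zero_ereal_def)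
      have "m = 0" if P: "\<forall>i\<le>m. primeideal (P i) R" "\<forall>i<m. P i \<subset> P (Suc i)" for m P
      proof (rule ccontr)
        assume "m \<noteq> 0"
        then have p: "primeideal (P 0) R" "primeideal (P 1) R" "P 0 \<subset> P 1" using P by auto
        then have "maximalideal (P 0) R" using * by blast
        then have "P 1 = P 0 \<or> P 1 = carrier R"
          using p(2,3) by (intro maximalideal.I_maximal)
            (auto simp: primeideal_def intro!: additive_subgroup.a_subset[THEN subsetD] ideal.axioms)
        then show False using p primeideal.I_notcarr by blast
      qed
      then show "krull_dim R \<le> 0" unfolding krull_dim_def by (intro Sup_least) (auto simp: zero_ereal_def)
    qed
  qed
qed

text \<open>This is the binomial expansion in \<open>x = v - 1\<close>, with everything from
  \<open>x^2\<close> on collected in \<open>w\<close>. If \<open>[n]\<close> annihilates the ring,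
  the linear term vanishes for \<open>i = n\<close>.\<close>

lemma (in cring) nat_pow_second_order:
  assumes v: "v \<in> carrier R"
  obtains w where "w \<in> carrier R"
    "v [^] (i::nat) = \<one> \<oplus> [i] \<cdot> (v \<ominus> \<one>) \<oplus> (v \<ominus> \<one>) \<otimes> (v \<ominus> \<one>) \<otimes> w"
proof -
  have "\<exists>w\<in>carrier R. v [^] i = \<one> \<oplus> [i] \<cdot> (v \<ominus> \<one>) \<oplus> (v \<ominus> \<one>) \<otimes> (v \<ominus> \<one>) \<otimes> w"
  proof (induction i)
    case 0
    show ?case using v by (intro bexI[of _ \<zero>]) auto
  next
    case (Suc i)
    then obtain w where w: "w \<in> carrier R"
      and eq: "v [^] i = \<one> \<oplus> [i] \<cdot> (v \<ominus> \<one>) \<oplus> (v \<ominus> \<one>) \<otimes> (v \<ominus> \<one>) \<otimes> w"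
      by blast
    define x where "x = v \<ominus> \<one>"
    have x: "x \<in> carrier R" and vx: "v = \<one> \<oplus> x" using v by (simp_all add: x_def minus_eq a_lcomm r_neg)
    define j where "j = [i] \<cdot> \<one>"
    have j: "j \<in> carrier R" by (simp add: j_def)
    have jx: "[i] \<cdot> x = j \<otimes> x" using x by (simp add: j_def add_pow_ldistr)
    have "v [^] Suc i = (\<one> \<oplus> j \<otimes> x \<oplus> x \<otimes> x \<otimes> w) \<otimes> (\<one> \<oplus> x)"
      using eq unfolding x_def[symmetric] jx by (simp add: vx)
    also have "\<dots> = \<one> \<oplus> (j \<otimes> x \<oplus> x) \<oplus> x \<otimes> x \<otimes> (w \<oplus> j \<oplus> x \<otimes> w)"
      using x j w by (simp add: l_distr r_distr m_ac a_ac)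
    also have "j \<otimes> x \<oplus> x = [Suc i] \<cdot> x" by (simp add: jx x)
    finally show ?case unfolding x_def[symmetric] using x j w by blast
  qed
  with that show ?thesis by blast
qed

subsection \<open>Zariski's lemma\<close>

text \<open>The element \<open>f = 1 + x d\<close> is coprime to \<open>d\<close>: with
  \<open>p = d^N\<close>, the relation \<open>f h = p d\<close> gives
  \<open>f (p - x h) = p\<close>. So the exponent can be lowered until \<open>f\<close> divides
  1.\<close>

lemma (in cring) Units_if_divides_power:
  assumes "x \<in> carrier R" "d \<in> carrier R" "h \<in> carrier R" "(\<one> \<oplus> x \<otimes> d) \<otimes> h = d [^] (N::nat)"
  shows "\<one> \<oplus> x \<otimes> d \<in> Units R"
  using assms
proof (induction N arbitrary: h)
  case 0
  then show ?case by (auto simp: Units_def intro!: bexI[of _ h] simp: m_comm)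
next
  case (Suc N)
  define p where "p = d [^] N"
  have p: "p \<in> carrier R" using Suc.prems by (simp add: p_def)
  have "(\<one> \<oplus> x \<otimes> d) \<otimes> (p \<ominus> x \<otimes> h) = p \<oplus> x \<otimes> (p \<otimes> d) \<ominus> x \<otimes> ((\<one> \<oplus> x \<otimes> d) \<otimes> h)"
    using Suc.prems(1-3) p by algebra
  also have "(\<one> \<oplus> x \<otimes> d) \<otimes> h = p \<otimes> d" using Suc.prems by (simp add: p_def)
  also have "p \<oplus> x \<otimes> (p \<otimes> d) \<ominus> x \<otimes> (p \<otimes> d) = p" using Suc.prems(1-3) p by algebra
  finally show ?case using Suc.IH[of "p \<ominus> x \<otimes> h"] Suc.prems p by (simp add: p_def)
qed

text \<open>The fraction field is realised inside the ambient field, so that it can be compared with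
  other subrings and can serve as a field of scalars there.\<close>

definition (in field) fractions :: "'a set \<Rightarrow> 'a set"
  where "fractions A = {a \<otimes> inv b | a b. a \<in> A \<and> b \<in> A \<and> b \<noteq> \<zero>}"

lemma (in field) nonzero_inv:
  assumes "b \<in> carrier R" "b \<noteq> \<zero>"
  shows "inv b \<in> carrier R" "b \<otimes> inv b = \<one>" "inv b \<otimes> b = \<one>" "inv b \<noteq> \<zero>"
proof -
  have "b \<in> Units R" using assms field_Units by blast
  then show "inv b \<in> carrier R" "b \<otimes> inv b = \<one>" "inv b \<otimes> b = \<one>" by auto
  then show "inv b \<noteq> \<zero>" using assms by auto
qed

text \<open>Clearing the denominator removes the inverse, so closure properties reduce to identities
  between products.\<close>

lemma (in field) fractions_iff:
  assumes "A \<subseteq> carrier R"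
  shows "x \<in> fractions A \<longleftrightarrow> x \<in> carrier R \<and> (\<exists>b\<in>A. b \<noteq> \<zero> \<and> x \<otimes> b \<in> A)"
proof
  assume "x \<in> fractions A"
  then obtain a b where ab: "x = a \<otimes> inv b" "a \<in> A" "b \<in> A" "b \<noteq> \<zero>" by (auto simp: fractions_def)
  with assms have c: "a \<in> carrier R" "b \<in> carrier R" by auto
  with ab nonzero_inv[of b] have "x \<otimes> b = a" by (simp add: m_assoc)
  with ab c nonzero_inv[of b] show "x \<in> carrier R \<and> (\<exists>b\<in>A. b \<noteq> \<zero> \<and> x \<otimes> b \<in> A)" by auto
next
  assume "x \<in> carrier R \<and> (\<exists>b\<in>A. b \<noteq> \<zero> \<and> x \<otimes> b \<in> A)"
  then obtain b where b: "x \<in> carrier R" "b \<in> A" "b \<noteq> \<zero>" "x \<otimes> b \<in> A" by blast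
  then have "x = (x \<otimes> b) \<otimes> inv b" using assms nonzero_inv[of b] by (auto simp: m_assoc)
  then show "x \<in> fractions A" using b unfolding fractions_def by blast
qed

lemma (in field) subset_fractions:
  assumes "subring A R"
  shows "A \<subseteq> fractions A"
  using subringE[OF assms] by (force simp: fractions_iff[OF subringE(1)[OF assms]])

lemma (in field) subfield_fractions:
  assumes A: "subring A R"
  shows "subfield (fractions A) R"
proof -
  note [simp] = fractions_iff[OF subringE(1)[OF A]]
  note c = subsetD[OF subringE(1)[OF A]]
  show ?thesis
  proof (intro subfieldI' subringI)
    show "fractions A \<subseteq> carrier R" by auto
    show "\<one> \<in> fractions A" using subset_fractions[OF A] subringE(3)[OF A] by blast
  next
    fix x assume "x \<in> fractions A"
    then show "\<ominus> x \<in> fractions A" using c subringE(5)[OF A] by (auto simp: l_minus intro!: bexI)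
  next
    fix x y assume "x \<in> fractions A" "y \<in> fractions A"
    then obtain b d where *: "x \<in> carrier R" "y \<in> carrier R" "b \<in> A" "b \<noteq> \<zero>" "x \<otimes> b \<in> A"
      "d \<in> A" "d \<noteq> \<zero>" "y \<otimes> d \<in> A" by auto
    have bd: "b \<otimes> d \<in> A" "b \<otimes> d \<noteq> \<zero>" using * c subringE(6)[OF A] integral by blast+
    have "(x \<otimes> y) \<otimes> (b \<otimes> d) = (x \<otimes> b) \<otimes> (y \<otimes> d)"
      "(x \<oplus> y) \<otimes> (b \<otimes> d) = (x \<otimes> b) \<otimes> d \<oplus> b \<otimes> (y \<otimes> d)"
      using * c by algebra+
    then show "x \<otimes> y \<in> fractions A" "x \<oplus> y \<in> fractions A"
      using * bd subringE(6,7)[OF A] by (auto intro!: bexI[of _ "b \<otimes> d"])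
  next
    fix x assume x: "x \<in> fractions A - {\<zero>}"
    then obtain b where *: "x \<in> carrier R" "b \<in> A" "b \<noteq> \<zero>" "x \<otimes> b \<in> A" "x \<noteq> \<zero>" by auto
    \<comment> \<open>The numerator \<open>x b\<close> of \<open>x\<close> becomes the denominator
      of \<open>inv x\<close>.\<close>
    have "inv x \<otimes> (x \<otimes> b) = b" using * c nonzero_inv[of x] by (simp add: m_assoc[symmetric])
    moreover have "x \<otimes> b \<noteq> \<zero>" using * c integral by blast
    ultimately show "inv x \<in> fractions A" using * nonzero_inv[of x] by (auto intro!: bexI[of _ "x \<otimes> b"])
  qed
qed

lemma (in field) fractions_common_denominator:
  assumes A: "subring A R" and "finite C" "C \<subseteq> fractions A"
  obtains D where "D \<in> A" "D \<noteq> \<zero>" "\<And>c. c \<in> C \<Longrightarrow> c \<otimes> D \<in> A"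
proof -
  note c = subsetD[OF subringE(1)[OF A]]
  from assms(2,3) have "\<exists>D\<in>A. D \<noteq> \<zero> \<and> (\<forall>c\<in>C. c \<otimes> D \<in> A)"
  proof (induction C)
    case empty
    then show ?case using subringE(3)[OF A] by (auto intro!: bexI[of _ \<one>])
  next
    case (insert x C)
    then obtain D where D: "D \<in> A" "D \<noteq> \<zero>" "\<forall>c\<in>C. c \<otimes> D \<in> A" by auto
    from insert obtain b where b: "x \<in> carrier R" "b \<in> A" "b \<noteq> \<zero>" "x \<otimes> b \<in> A"
      by (auto simp: fractions_iff[OF subringE(1)[OF A]])
    have C: "C \<subseteq> carrier R" using insert by (auto simp: fractions_iff[OF subringE(1)[OF A]])
    have "y \<otimes> (b \<otimes> D) \<in> A" if "y \<in> insert x C" for y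
    proof (cases "y = x")
      case True
      have "x \<otimes> (b \<otimes> D) = x \<otimes> b \<otimes> D" using b D c by (simp add: m_assoc)
      then show ?thesis using True b D subringE(6)[OF A] by simp
    next
      case False
      then have "y \<in> C" using that by simp
      then have "y \<otimes> (b \<otimes> D) = b \<otimes> (y \<otimes> D)" using b D c C by (intro m_lcomm) auto
      then show ?thesis using \<open>y \<in> C\<close> b D subringE(6)[OF A] by simp
    qed
    moreover have "b \<otimes> D \<in> A" "b \<otimes> D \<noteq> \<zero>" using b D c subringE(6)[OF A] integral by blast+
    ultimately show ?case by blast
  qed
  with that show ?thesis by blast
qed

text \<open>
  Artin-Tate without a Noetherian hypothesis: take for \<open>C\<close> the coordinates of the products \<open>u e\<close>
  (\<open>u \<in> U\<close>, \<open>e\<close> in a basis containing \<open>1\<close>). The \<open>B\<close>-span of the basis is then stable under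
  multiplication by \<open>k\<close> and \<open>U\<close>, hence is the whole field, and comparing coordinates gives \<open>L = B\<close>.
\<close>

lemma (in field) subfield_finitely_generated:
  assumes L: "subfield L R" "finite_dimension L (carrier R)"
    and U: "finite U" "U \<subseteq> carrier R" "k \<subseteq> L"
    and gen: "\<And>B. subring B R \<Longrightarrow> k \<union> U \<subseteq> B \<Longrightarrow> B = carrier R"
  obtains C where "finite C" "C \<subseteq> L" "\<And>B. subring B R \<Longrightarrow> B \<subseteq> L \<Longrightarrow> k \<union> C \<subseteq> B \<Longrightarrow> B = L"
proof -
  obtain n where n: "dimension n L (carrier R)" using L(2) by blast
  \<comment> \<open>The basis is completed from \<open>[\<one>]\<close> so that 1 stands last; an
    element \<open>l\<close> of \<open>L\<close> then has coordinates zero except for a final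
    \<open>l\<close>.\<close>
  have "\<one> \<notin> Span L []" by simp
  then have "independent L [\<one>]" by (intro li_Cons) auto
  from complete_base[OF L(1) n this] obtain Vs where
    ind: "independent L (Vs @ [\<one>])" and span: "Span L (Vs @ [\<one>]) = carrier R" by auto
  define es where "es = Vs @ [\<one>]"
  have es: "set es \<subseteq> carrier R" using independent_in_carrier[OF ind] by (simp add: es_def)
  have unique: "\<exists>!cs. set cs \<subseteq> L \<and> length cs = length es \<and> x = combine cs es" if "x \<in> carrier R" for x
    using unique_decomposition[OF L(1) ind] that span by (simp add: es_def)
  define co where "co x = (THE cs. set cs \<subseteq> L \<and> length cs = length es \<and> x = combine cs es)" for x
  have co: "set (co x) \<subseteq> L \<and> length (co x) = length es \<and> x = combine (co x) es" if "x \<in> carrier R" for x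
    unfolding co_def by (rule theI'[OF unique[OF that]])
  define C where "C = (\<Union>u\<in>U. \<Union>e\<in>set es. set (co (u \<otimes> e)))"
  have "finite C" using U by (simp add: C_def)
  moreover have "C \<subseteq> L" unfolding C_def using co U(2) es by blast
  moreover have "B = L" if B: "subring B R" "B \<subseteq> L" "k \<union> C \<subseteq> B" for B
  proof -
    note Bc = subringE(1)[OF B(1)]
    define M where "M = {combine cs es | cs. set cs \<subseteq> B \<and> length cs = length es}"
    have Mc: "M \<subseteq> carrier R" unfolding M_def using combine_in_carrier Bc es by blast
    have M_add: "x \<oplus> y \<in> M" if "x \<in> M" "y \<in> M" for x y
    proof -
      from that obtain cs ds where *: "x = combine cs es" "set cs \<subseteq> B" "length cs = length es"
        "y = combine ds es" "set ds \<subseteq> B" "length ds = length es" by (auto simp: M_def)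
      then have "x \<oplus> y = combine (map2 (\<oplus>) cs ds) es" using combine_add Bc es by simp
      moreover have "set (map2 (\<oplus>) cs ds) \<subseteq> B"
        using * subringE(7)[OF B(1)]
        by (auto dest: set_zip_leftD set_zip_rightD intro!: subringE(7)[OF B(1)])
      moreover have "length (map2 (\<oplus>) cs ds) = length es" using * by simp
      ultimately show ?thesis unfolding M_def by blast
    qed
    have M_smult: "b \<otimes> x \<in> M" if "b \<in> B" "x \<in> M" for b x
    proof -
      from that obtain cs where *: "x = combine cs es" "set cs \<subseteq> B" "length cs = length es"
        by (auto simp: M_def)
      then have "b \<otimes> x = combine (map ((\<otimes>) b) cs) es" using combine_r_distr[of cs es b] Bc es that by auto
      moreover have "set (map ((\<otimes>) b) cs) \<subseteq> B" using * that subringE(6)[OF B(1)] by auto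
      ultimately show ?thesis unfolding M_def using * by force
    qed
    have M_zero: "\<zero> \<in> M"
      unfolding M_def using combine_replicate[OF es] subringE(2)[OF B(1)]
      by (auto intro!: exI[of _ "replicate (length es) \<zero>"])
    have M_U: "u \<otimes> x \<in> M" if "u \<in> U" "x \<in> M" for u x
    proof -
      \<comment> \<open>The list \<open>es\<close> is fixed in \<open>M\<close> and
        \<open>C\<close>, so the induction runs over arbitrary lists \<open>fs\<close> of basis
        elements instead.\<close>
      have "set cs \<subseteq> B \<Longrightarrow> set fs \<subseteq> set es \<Longrightarrow> u \<otimes> combine cs fs \<in> M" for cs fs
      proof (induction cs fs rule: combine.induct)
        case (1 c cs f fs)
        have "u \<otimes> f \<in> carrier R" using that 1 U(2) es by auto
        note co = co[OF this]
        have "f \<in> set es" using 1(3) by simp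
        then have "set (co (u \<otimes> f)) \<subseteq> C" using \<open>u \<in> U\<close> unfolding C_def by blast
        then have "set (co (u \<otimes> f)) \<subseteq> B" using B(3) by blast
        then have "u \<otimes> f \<in> M" unfolding M_def using co by blast
        then have "c \<otimes> (u \<otimes> f) \<oplus> u \<otimes> combine cs fs \<in> M" using 1 M_add M_smult by simp
        moreover have "u \<otimes> combine (c # cs) (f # fs) = c \<otimes> (u \<otimes> f) \<oplus> u \<otimes> combine cs fs"
        proof -
          have "u \<in> carrier R" "c \<in> carrier R" "f \<in> carrier R" "combine cs fs \<in> carrier R"
            using that U(2) 1(2,3) Bc es by (auto intro!: combine_in_carrier)
          then show ?thesis by (simp add: r_distr m_lcomm)
        qed
        ultimately show ?case by simp
      qed (use that U(2) M_zero in auto)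
      with that show ?thesis by (auto simp: M_def)
    qed
    \<comment> \<open>The multipliers that preserve \<open>M\<close> form a subring. It contains
      \<open>k\<close> and \<open>U\<close>, so it is the whole field, and applying it to 1 shows
      that \<open>M\<close> is everything.\<close>
    define T where "T = {x \<in> carrier R. \<forall>m\<in>M. x \<otimes> m \<in> M}"
    have "subring T R"
    proof (rule subringI)
      fix x assume "x \<in> T"
      moreover have "\<ominus> x \<otimes> m = \<ominus> \<one> \<otimes> (x \<otimes> m)" if "x \<in> carrier R" "m \<in> M" for m
        using that Mc by (auto simp: l_minus)
      ultimately show "\<ominus> x \<in> T" using M_smult subringE(3,5)[OF B(1)] by (auto simp: T_def)
    qed (use Mc M_add in \<open>auto simp: T_def m_assoc l_distr subset_iff\<close>)
    moreover have "k \<union> U \<subseteq> T"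
      using U(2) B(3) Bc M_U M_smult by (auto simp: T_def)
    ultimately have T: "T = carrier R" by (rule gen)
    have comb: "combine (replicate (length Vs) \<zero> @ [l]) es = l" if "l \<in> carrier R" for l
      unfolding es_def using that es combine_prepend_replicate[of "[l]" "Vs @ [\<one>]" "length Vs"]
      by (simp add: es_def)
    have "\<one> \<in> M"
      unfolding M_def using comb[of \<one>] subringE(2,3)[OF B(1)]
      by (auto intro!: exI[of _ "replicate (length Vs) \<zero> @ [\<one>]"] simp: es_def)
    have "L \<subseteq> B"
    proof
      fix l assume l: "l \<in> L"
      then have lc: "l \<in> carrier R" using subfieldE(3)[OF L(1)] by blast
      then have "l \<otimes> \<one> \<in> M" using T \<open>\<one> \<in> M\<close> unfolding T_def by blast
      with lc obtain cs where cs: "l = combine cs es" "set cs \<subseteq> B" "length cs = length es"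
        by (auto simp: M_def)
      \<comment> \<open>Both lists are coordinates of \<open>l\<close> over \<open>L\<close>, hence
        equal; so \<open>l\<close> is itself an entry of a list with entries in
        \<open>B\<close>.\<close>
      have "cs = replicate (length Vs) \<zero> @ [l]"
      proof (rule ex1E[OF unique[OF lc]], elim conjE)
        fix ds assume *: "\<forall>y. set y \<subseteq> L \<and> length y = length es \<and> l = combine y es \<longrightarrow> y = ds"
        have "set cs \<subseteq> L" "set (replicate (length Vs) \<zero> @ [l]) \<subseteq> L"
          using cs B(2) l subringE(2)[OF subfieldE(1)[OF L(1)]] by auto
        then have "replicate (length Vs) \<zero> @ [l] = ds"
          using comb[OF lc] by (intro *[rule_format] conjI) (simp_all add: es_def)
        moreover have "cs = ds" using \<open>set cs \<subseteq> L\<close> cs by (intro *[rule_format] conjI)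
        ultimately show ?thesis by simp
      qed
      then have "l \<in> set cs" by simp
      then show "l \<in> B" using cs(2) by blast
    qed
    with B show ?thesis by blast
  qed
  ultimately show ?thesis by (rule that)
qed

text \<open>
  With a common denominator \<open>D\<close> of \<open>C\<close>, every fraction lies in \<open>k[t][1/D]\<close>. For transcendental \<open>t\<close>
  this fails for the inverse of \<open>1 + t D\<close>, which is coprime to \<open>D\<close> and not constant.
\<close>

lemma (in field) algebraic_if_fractions_finitely_generated:
  assumes k: "subfield k R" and t: "t \<in> carrier R"
    and C: "finite C" "C \<subseteq> fractions (simple_extension k t)"
    and gen: "\<And>B. subring B R \<Longrightarrow> B \<subseteq> fractions (simple_extension k t) \<Longrightarrow> k \<union> C \<subseteq> B
      \<Longrightarrow> B = fractions (simple_extension k t)"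
  shows "(algebraic over k) t"
proof (rule ccontr)
  let ?A = "simple_extension k t"
  let ?L = "fractions ?A"
  note kr = subfieldE(1)[OF k]
  have A: "subring ?A R" by (rule simple_extension_is_subring[OF kr t])
  note L = subfieldE(1)[OF subfield_fractions[OF A]]
  note Ac = subringE(1)[OF A]
  assume "\<not> (algebraic over k) t"
  then have inj: "inj_on (\<lambda>p. eval p t) (carrier (k[X]))" by (simp add: over_def transcendental_def)
  interpret UP: domain "k[X]" by (rule univ_poly_is_domain[OF kr])
  interpret ev: ring_hom_ring "k[X]" R "\<lambda>p. eval p t" by (rule eval_ring_hom[OF kr t])
  have A_eval: "?A = (\<lambda>p. eval p t) ` carrier (k[X])"
    by (rule simple_extension_as_eval_img[OF subringE(1)[OF kr] t])
  obtain D where D: "D \<in> ?A" "D \<noteq> \<zero>" "\<And>c. c \<in> C \<Longrightarrow> c \<otimes> D \<in> ?A"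
    by (rule fractions_common_denominator[OF A C]) blast
  have Dc: "D \<in> carrier R" using D Ac by blast
  \<comment> \<open>This is the localisation of \<open>k[t]\<close> at the powers of
    \<open>D\<close>. It contains \<open>k\<close> and \<open>C\<close>, so the generation
    hypothesis makes it all of the fraction field.\<close>
  define B where "B = {x \<in> ?L. \<exists>N::nat. x \<otimes> D [^] N \<in> ?A}"
  have pow: "D [^] (N::nat) \<in> ?A" for N
    using D by (induction N) (auto intro: subringE(3,6)[OF A])
  have raise: "x \<otimes> D [^] (N + N') \<in> ?A" if "x \<in> ?L" "x \<otimes> D [^] N \<in> ?A" for x and N N' :: nat
  proof -
    have "x \<otimes> D [^] (N + N') = x \<otimes> D [^] N \<otimes> D [^] N'"
      using that subringE(1)[OF L] Dc by (auto simp: nat_pow_mult[symmetric] m_assoc)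
    then show ?thesis using that pow subringE(6)[OF A] by simp
  qed
  have "subring B R"
  proof (rule subringI)
    show "B \<subseteq> carrier R" using subringE(1)[OF L] by (auto simp: B_def)
    show "\<one> \<in> B" using subringE(3)[OF L] pow[of 0] by (auto simp: B_def intro!: exI[of _ "0::nat"])
  next
    fix x assume "x \<in> B"
    then show "\<ominus> x \<in> B"
      using subringE(1,5)[OF L] subringE(5)[OF A] Dc by (force simp: B_def l_minus)
  next
    fix x y assume "x \<in> B" "y \<in> B"
    then obtain N N' where *: "x \<in> ?L" "y \<in> ?L" "x \<otimes> D [^] (N::nat) \<in> ?A" "y \<otimes> D [^] (N'::nat) \<in> ?A"
      by (auto simp: B_def)
    then have c: "x \<in> carrier R" "y \<in> carrier R" using subringE(1)[OF L] by auto
    have "(x \<oplus> y) \<otimes> D [^] (N + N') = x \<otimes> D [^] (N + N') \<oplus> y \<otimes> D [^] (N' + N)"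
      using c Dc by (simp add: l_distr add.commute)
    then have "(x \<oplus> y) \<otimes> D [^] (N + N') \<in> ?A" using * raise subringE(7)[OF A] by simp
    then show "x \<oplus> y \<in> B" using * subringE(7)[OF L] unfolding B_def by blast
    have "(x \<otimes> y) \<otimes> D [^] (N + N') = (x \<otimes> D [^] N) \<otimes> (y \<otimes> D [^] N')"
      using c Dc by (simp add: nat_pow_mult[symmetric] m_ac)
    then have "(x \<otimes> y) \<otimes> D [^] (N + N') \<in> ?A" using * subringE(6)[OF A] by simp
    then show "x \<otimes> y \<in> B" using * subringE(6)[OF L] unfolding B_def by blast
  qed
  moreover have "k \<union> C \<subseteq> B"
  proof
    fix x assume "x \<in> k \<union> C"
    then show "x \<in> B"
    proof
      assume "x \<in> k"
      then have "x \<in> ?A" using simple_extension_incl[OF subringE(1)[OF kr] t] by blast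
      then have "x \<in> ?L" "x \<otimes> D [^] (0::nat) \<in> ?A" using subset_fractions[OF A] Ac by auto
      then show "x \<in> B" unfolding B_def by blast
    next
      assume "x \<in> C"
      then have "x \<in> ?L" "x \<otimes> D [^] (1::nat) \<in> ?A" using C D Dc by auto
      then show "x \<in> B" unfolding B_def by blast
    qed
  qed
  ultimately have "B = ?L" by (intro gen) (auto simp: B_def)
  from D(1)[unfolded A_eval] obtain d where d: "d \<in> carrier (k[X])" "eval d t = D" by auto
  have Xc: "X \<in> carrier (k[X])" by (rule var_closed(1)[OF kr])
  \<comment> \<open>The factor \<open>X\<close> keeps \<open>f\<close> nonconstant even when
    \<open>d\<close> is a constant.\<close>
  define f where "f = \<one>\<^bsub>k[X]\<^esub> \<oplus>\<^bsub>k[X]\<^esub> X \<otimes>\<^bsub>k[X]\<^esub> d"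
  have f: "f \<in> carrier (k[X])" using d Xc by (simp add: f_def)
  have dnil: "d \<noteq> []" using d D(2) by auto
  have deg: "degree (X \<otimes>\<^bsub>k[X]\<^esub> d) = Suc (degree d)"
    using poly_mult_degree_eq[OF kr var_closed(2)[OF kr], of d] d dnil
    by (simp add: univ_poly_mult univ_poly_carrier var_def)
  have f_not_const: "degree f \<noteq> 0"
  proof
    assume f0: "degree f = 0"
    have "X \<otimes>\<^bsub>k[X]\<^esub> d = f \<oplus>\<^bsub>k[X]\<^esub> (\<ominus>\<^bsub>k[X]\<^esub> \<one>\<^bsub>k[X]\<^esub>)"
      using d Xc UP.a_comm[of "\<one>\<^bsub>k[X]\<^esub>" "X \<otimes>\<^bsub>k[X]\<^esub> d"]
      by (simp add: f_def UP.a_assoc UP.r_neg)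
    also have "degree \<dots> \<le> max (degree f) (degree (\<ominus>\<^bsub>k[X]\<^esub> \<one>\<^bsub>k[X]\<^esub>))"
      unfolding univ_poly_add by (rule poly_add_degree)
    also have "degree (\<ominus>\<^bsub>k[X]\<^esub> \<one>\<^bsub>k[X]\<^esub>) = 0"
      unfolding univ_poly_a_inv_def'[OF kr UP.one_closed] by (simp add: univ_poly_one)
    finally show False using deg f0 by simp
  qed
  have fnz: "eval f t \<noteq> \<zero>"
  proof
    assume "eval f t = \<zero>"
    \<comment> \<open>The zero polynomial is the empty list, whose \<open>degree\<close> is 0 by
      convention, so \<open>f_not_const\<close> excludes it.\<close>
    then have "f = []" using inj_onD[OF inj, of f "[]"] f univ_poly_zero_closed[of R k] by simp
    then show False using f_not_const by simp
  qed
  have "eval f t \<in> ?A" using f unfolding A_eval by (rule imageI)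
  then have "inv (eval f t) \<in> ?L"
    using subset_fractions[OF A] fnz subfield_m_inv(1)[OF subfield_fractions[OF A]] by blast
  then obtain N where "inv (eval f t) \<otimes> D [^] (N::nat) \<in> ?A" using \<open>B = ?L\<close> unfolding B_def by blast
  from this[unfolded A_eval] obtain h
    where h: "h \<in> carrier (k[X])" "eval h t = inv (eval f t) \<otimes> D [^] N" by auto
  \<comment> \<open>Evaluation at the transcendental \<open>t\<close> is injective, so this equality
    of values becomes the polynomial identity \<open>f h = d^N\<close>. It makes \<open>f\<close> a
    unit, that is, a nonzero constant.\<close>
  have "eval (f \<otimes>\<^bsub>k[X]\<^esub> h) t = eval f t \<otimes> (inv (eval f t) \<otimes> D [^] N)" using f h by simp
  also have "\<dots> = eval (d [^]\<^bsub>k[X]\<^esub> N) t"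
    using nonzero_inv[of "eval f t"] fnz f Dc d ev.hom_nat_pow[of d N] by (simp add: m_assoc[symmetric])
  finally have "f \<otimes>\<^bsub>k[X]\<^esub> h = d [^]\<^bsub>k[X]\<^esub> N" using f h d by (intro inj_onD[OF inj]) auto
  then have "f \<in> Units (k[X])"
    unfolding f_def by (rule UP.Units_if_divides_power[OF Xc d(1) h(1)])
  then show False using f_not_const univ_poly_units'[OF k, of f] by simp
qed

text \<open>Zariski's lemma by induction on the generators, for all base fields at once. The
  induction hypothesis is used twice: over the fractions of \<open>k[t]\<close>, to show that
  \<open>t\<close> is algebraic, and then over \<open>k[t]\<close>, which is now a field finite over
  \<open>k\<close>. Expressing generation through subrings avoids polynomials in several
  variables.\<close>

lemma (in field) finite_dimension_if_finitely_generated: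
  assumes "subfield k R" "set us \<subseteq> carrier R"
    and "\<And>B. subring B R \<Longrightarrow> k \<union> set us \<subseteq> B \<Longrightarrow> B = carrier R"
  shows "finite_dimension k (carrier R)"
  using assms
proof (induction us arbitrary: k)
  case Nil
  then have "k = carrier R" using subfieldE(1) by auto
  then show ?case using dimension_one[OF Nil(1)] finite_dimensionI by metis
next
  case (Cons t us)
  let ?A = "simple_extension k t"
  have t: "t \<in> carrier R" using Cons by simp
  note kr = subfieldE(1)[OF Cons.prems(1)]
  have A: "subring ?A R" by (rule simple_extension_is_subring[OF kr t])
  have kA: "k \<subseteq> ?A" "t \<in> ?A"
    using simple_extension_incl[OF subringE(1)[OF kr] t] simple_extension_mem[OF kr t] by auto
  have IH: "finite_dimension L (carrier R)" if "subfield L R" "?A \<subseteq> L" for L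
  proof (rule Cons.IH[OF that(1)])
    show "B = carrier R" if B: "subring B R" "L \<union> set us \<subseteq> B" for B
      by (rule Cons.prems(3)[OF B(1)]) (use B(2) kA \<open>?A \<subseteq> L\<close> in auto)
  qed (use Cons.prems in auto)
  have "(algebraic over k) t"
  proof -
    have L: "subfield (fractions ?A) R" by (rule subfield_fractions[OF A])
    note sub = subset_fractions[OF A]
    obtain C where "finite C" "C \<subseteq> fractions ?A"
      "\<And>B. subring B R \<Longrightarrow> B \<subseteq> fractions ?A \<Longrightarrow> k \<union> C \<subseteq> B \<Longrightarrow> B = fractions ?A"
      by (rule subfield_finitely_generated[OF L IH[OF L sub] _ Cons.prems(2) _ Cons.prems(3)])
        (use kA sub in auto)
    then show ?thesis by (rule algebraic_if_fractions_finitely_generated[OF Cons.prems(1) t])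
  qed
  then have "subfield ?A R" "finite_dimension k ?A"
    using simple_extension_is_subfield finite_dimension_simple_extension Cons.prems(1) t by blast+
  then show ?case using telescopic_base_dim(1)[OF Cons.prems(1)] IH by blast
qed

section \<open>Finiteness of finitely generated fields of positive characteristic\<close>

lemma (in ring) finite_dimension_imp_finite:
  assumes "subfield k R" "finite k" "finite_dimension k E"
  shows "finite E"
proof -
  obtain n where "dimension n k E" using assms(3) by blast
  then obtain Us where Us: "set Us \<subseteq> carrier R" "Span k Us = E" using exists_base[OF assms(1)] by blast
  then have "E = (\<lambda>Ks. combine Ks Us) ` {Ks. set Ks \<subseteq> k \<and> length Ks = length Us}"
    using Span_eq_combine_set_length_version[OF assms(1) Us(1)] by auto
  then show ?thesis using finite_lists_length_eq[OF assms(2)] by simp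
qed

text \<open>The prime field is the additive group generated by 1, finite because \<open>[n]\<close>
  kills 1. Multiplication by a nonzero element is injective on this finite set, hence onto, which
  supplies inverses.\<close>

lemma (in field) finite_subfield_exists:
  assumes "0 < (n::nat)" "[n] \<cdot> \<one> = \<zero>"
  obtains k where "subfield k R" "finite k"
proof -
  define k where "k = generate (add_monoid R) {\<one>}"
  have fin: "finite k"
    unfolding k_def using assms by (intro add.finite_generate) auto
  have sg: "subgroup k (add_monoid R)" unfolding k_def by (intro add.generate_is_subgroup) simp
  have kc: "k \<subseteq> carrier R" using subgroup.subset[OF sg] by simp
  have one: "\<one> \<in> k" unfolding k_def by (simp add: generate.incl)
  have mult: "x \<otimes> y \<in> k" if "x \<in> k" "y \<in> k" for x y
    using that(1)[unfolded k_def] that(2)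
  proof induction
    case one
    then show ?case using kc subgroup.one_closed[OF sg] by auto
  next
    case (incl h)
    then show ?case using kc by auto
  next
    case (inv h)
    then show ?case using kc subgroup.m_inv_closed[OF sg, of y]
      by (auto simp: l_minus a_inv_def[symmetric])
  next
    case (eng a b)
    then have "a \<in> carrier R" "b \<in> carrier R" using add.generate_in_carrier[of "{\<one>}"] by auto
    then show ?case using eng kc subgroup.m_closed[OF sg] by (auto simp: l_distr)
  qed
  have "subring k R"
    using kc one mult subgroup.m_closed[OF sg] subgroup.m_inv_closed[OF sg]
    by (intro subringI) (auto simp: a_inv_def)
  then have "subfield k R"
  proof (rule subfieldI')
    fix x assume x: "x \<in> k - {\<zero>}"
    have "inj_on ((\<otimes>) x) k"
      using x kc m_lcancel[of x] by (auto intro!: inj_onI simp: subset_iff)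
    then have "(\<otimes>) x ` k = k" using mult x by (intro endo_inj_surj fin) auto
    then obtain y where "y \<in> k" "x \<otimes> y = \<one>" using one by (metis imageE)
    then show "inv x \<in> k" using x kc comm_inv_char[of x y] by auto
  qed
  with fin that show ?thesis by blast
qed

lemma (in field) finite_if_finitely_generated:
  assumes "0 < (n::nat)" "[n] \<cdot> \<one> = \<zero>" "finite U" "U \<subseteq> carrier R"
    and "\<And>B. subring B R \<Longrightarrow> U \<subseteq> B \<Longrightarrow> B = carrier R"
  shows "finite (carrier R)"
proof -
  obtain k where k: "subfield k R" "finite k" by (rule finite_subfield_exists[OF assms(1,2)])
  obtain us where "U = set us" using finite_list[OF assms(3)] by blast
  then have "finite_dimension k (carrier R)"
    using assms(4,5) k by (intro finite_dimension_if_finitely_generated[of k us]) auto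
  then show ?thesis using finite_dimension_imp_finite k by blast
qed

subsection \<open>Zero-dimensional rings generated by units\<close>

text \<open>A finite domain is a field, argued here without passing to the quotient. For
  \<open>x\<close> in \<open>J\<close> but not in \<open>P\<close> two powers coincide, so
  \<open>x^i (1 - x^(m+1))\<close> is zero. Primeness puts \<open>1 - x^(m+1)\<close> into
  \<open>P\<close>, hence into \<open>J\<close>, and so 1 lies in \<open>J\<close>.\<close>

lemma (in cring) krull_dim_eq_zero_if_finite:
  assumes fin: "finite (carrier R)" and "\<one> \<noteq> \<zero>"
  shows "krull_dim R = 0"
proof -
  have "maximalideal P R" if P: "primeideal P R" for P
  proof (rule maximalidealI)
    interpret P: primeideal P R by fact
    show "ideal P R" by (rule P.is_ideal)
    show "carrier R \<noteq> P" by (rule P.I_notcarr)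
    fix J assume J: "ideal J R" "P \<subseteq> J" "J \<subseteq> carrier R"
    interpret J: ideal J R by fact
    show "J = P \<or> J = carrier R"
    proof (cases "J = P")
      case False
      then obtain x where x: "x \<in> J" "x \<notin> P" "x \<in> carrier R" using J by blast
      have x_pow: "x [^] i \<notin> P" for i :: nat
      proof (induction i)
        case 0
        then show ?case using P.one_imp_carrier P.I_notcarr by auto
      next
        case (Suc i)
        then show ?case using P.I_prime[of "x [^] i" x] x by auto
      qed
      have "range (\<lambda>i::nat. x [^] i) \<subseteq> carrier R" using x by auto
      then have "\<not> inj (\<lambda>i::nat. x [^] i)"
        using fin finite_subset finite_imageD infinite_UNIV_nat by blast
      then obtain i j :: nat where "x [^] i = x [^] j" "i < j"
        unfolding inj_on_def by (metis linorder_neqE_nat)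
      then obtain m where m: "x [^] i = x [^] (i + Suc m)" by (auto dest: less_imp_Suc_add)
      have "x [^] i \<otimes> (\<one> \<ominus> x [^] Suc m) = x [^] i \<ominus> x [^] (i + Suc m)"
        using x by (simp add: minus_eq r_distr r_minus nat_pow_mult[symmetric] m_ac del: nat_pow_Suc add_Suc_right)
      also have "\<dots> = \<zero>" using m x by (simp add: minus_eq r_neg)
      finally have "x [^] i \<otimes> (\<one> \<ominus> x [^] Suc m) \<in> P" using P.zero_closed by simp
      then have "\<one> \<ominus> x [^] Suc m \<in> P" using P.I_prime[of "x [^] i" "\<one> \<ominus> x [^] Suc m"] x x_pow by auto
      then have "\<one> \<ominus> x [^] Suc m \<in> J" using J by blast
      moreover have "x [^] Suc m \<in> J" using x J.I_l_closed by simp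
      ultimately have "(\<one> \<ominus> x [^] Suc m) \<oplus> x [^] Suc m \<in> J" by (rule J.a_closed)
      also have "(\<one> \<ominus> x [^] Suc m) \<oplus> x [^] Suc m = \<one>"
        using x by (simp add: minus_eq a_assoc l_neg del: nat_pow_Suc)
      finally show ?thesis using J.one_imp_carrier by blast
    qed simp
  qed
  then show ?thesis using krull_dim_eq_zero_iff[OF is_cring] assms by blast
qed

lemma (in comm_monoid) UnitsI_right_inverse:
  assumes "x \<in> carrier G" "y \<in> carrier G" "x \<otimes> y = \<one>"
  shows "x \<in> Units G"
  using assms by (auto simp: Units_def m_comm intro!: bexI[of _ y])

lemma FactRing_carrier: "carrier (R Quot I) = (+>\<^bsub>R\<^esub>) I ` carrier R"
  unfolding FactRing_def A_RCOSETS_def' by auto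

lemma FactRing_zero: "\<zero>\<^bsub>R Quot I\<^esub> = I"
  by (simp add: FactRing_def)

lemma (in cring) minus_one_dvd_pow_minus_one:
  assumes x: "x \<in> carrier R"
  obtains c where "c \<in> carrier R" "x [^] (l::nat) \<ominus> \<one> = (x \<ominus> \<one>) \<otimes> c"
proof -
  have "\<exists>c\<in>carrier R. x [^] l \<ominus> \<one> = (x \<ominus> \<one>) \<otimes> c"
  proof (induction l)
    case 0
    show ?case using x by (intro bexI[of _ \<zero>]) (auto simp: minus_eq r_neg)
  next
    case (Suc l)
    then obtain c where c: "c \<in> carrier R" "x [^] l \<ominus> \<one> = (x \<ominus> \<one>) \<otimes> c" by blast
    have "x [^] Suc l \<ominus> \<one> = (x [^] l \<ominus> \<one>) \<otimes> x \<oplus> (x \<ominus> \<one>)"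
      using x by (simp add: minus_eq l_distr l_minus a_assoc r_neg1)
    also have "\<dots> = (x \<ominus> \<one>) \<otimes> (c \<otimes> x \<oplus> \<one>)"
      unfolding c(2) using x c(1) by (simp add: r_distr m_assoc)
    finally show ?case using x c(1) by blast
  qed
  with that show ?thesis by blast
qed

lemma (in cring) Units_finite_order:
  assumes dim: "krull_dim R = 0" and n: "0 < (n::nat)" "[n] \<cdot> \<one> = \<zero>"
    and U: "finite U" "U \<subseteq> carrier R" "\<And>B. subring B R \<Longrightarrow> U \<subseteq> B \<Longrightarrow> B = carrier R"
    and u: "u \<in> Units R"
  shows "\<exists>k::nat. 0 < k \<and> u [^] k = \<one>"
proof (rule ccontr)
  assume no: "\<not> ?thesis"
  have uc [simp]: "u \<in> carrier R" using u by auto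
  have n_zero: "[n] \<cdot> x = \<zero>" if "x \<in> carrier R" for x
    using add_pow_ldistr[of \<one> x n] that n(2) by simp
  let ?M = "{u [^] k \<ominus> \<one> | k::nat. 0 < k}"
  have mult: "\<exists>c\<in>carrier R. a \<otimes> b \<otimes> c \<in> ?M" if ab: "a \<in> ?M" "b \<in> ?M" for a b
  proof -
    obtain k l :: nat where kl: "0 < k" "a = u [^] k \<ominus> \<one>" "0 < l" "b = u [^] l \<ominus> \<one>" using ab by auto
    \<comment> \<open>The exponent is a common multiple of \<open>k\<close> and \<open>l\<close>, so
      \<open>v - 1\<close> is divisible by both \<open>a\<close> and \<open>b\<close>, and its
      square by \<open>a b\<close>.\<close>
    define v where "v = u [^] (k * l)"
    have vc: "v \<in> carrier R" by (simp add: v_def)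
    obtain c where c: "c \<in> carrier R" "v \<ominus> \<one> = a \<otimes> c"
      using minus_one_dvd_pow_minus_one[of "u [^] k" l] by (auto simp: v_def kl nat_pow_pow)
    obtain d where d: "d \<in> carrier R" "v \<ominus> \<one> = b \<otimes> d"
      using minus_one_dvd_pow_minus_one[of "u [^] l" k] by (auto simp: v_def kl nat_pow_pow mult.commute)
    obtain w where w: "w \<in> carrier R"
      "v [^] n = \<one> \<oplus> [n] \<cdot> (v \<ominus> \<one>) \<oplus> (v \<ominus> \<one>) \<otimes> (v \<ominus> \<one>) \<otimes> w"
      using nat_pow_second_order[OF vc] by blast
    define z where "z = (v \<ominus> \<one>) \<otimes> (v \<ominus> \<one>) \<otimes> w"
    have zc: "z \<in> carrier R" using vc w by (simp add: z_def)
    have "v [^] n = \<one> \<oplus> z" using w(2) n_zero[of "v \<ominus> \<one>"] vc by (simp add: z_def)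
    then have "v [^] n \<ominus> \<one> = z" using zc by (simp add: minus_eq a_ac r_neg)
    also have "z = a \<otimes> b \<otimes> (c \<otimes> d \<otimes> w)"
    proof -
      have "z = (a \<otimes> c) \<otimes> (b \<otimes> d) \<otimes> w" unfolding z_def using c d by metis
      then show ?thesis using c d w kl by (simp add: m_ac)
    qed
    finally have "a \<otimes> b \<otimes> (c \<otimes> d \<otimes> w) = u [^] (k * l * n) \<ominus> \<one>"
      by (simp add: v_def nat_pow_pow)
    then show ?thesis using c d w kl n(1) by (intro bexI[of _ "c \<otimes> d \<otimes> w"]) auto
  qed
  have "{\<zero>} \<inter> ?M = {}" using no by (auto dest!: sym[of "\<zero>"])
  then obtain P where P: "primeideal P R" "P \<inter> ?M = {}"
  proof (rule exists_prime_avoiding[OF zeroideal])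
    show "?M \<subseteq> carrier R" "?M \<noteq> {}" by auto
  qed (use mult in auto)
  then have max: "maximalideal P R" using dim krull_dim_eq_zero_iff[OF is_cring] by blast
  interpret P: primeideal P R by fact
  interpret F: field "R Quot P" by (rule maximalideal.quotient_is_field[OF max is_cring])
  interpret h: ring_hom_ring R "R Quot P" "(+>) P" by (rule P.rcos_ring_hom_ring)
  have surj: "carrier (R Quot P) = (+>) P ` carrier R"
    by (rule FactRing_carrier)
  have h_pow: "P +> ([i] \<cdot> \<one>) = [i] \<cdot>\<^bsub>R Quot P\<^esub> \<one>\<^bsub>R Quot P\<^esub>" for i :: nat
    by (induction i) auto
  have "finite (carrier (R Quot P))"
  proof (rule F.finite_if_finitely_generated[OF n(1)])
    show "[n] \<cdot>\<^bsub>R Quot P\<^esub> \<one>\<^bsub>R Quot P\<^esub> = \<zero>\<^bsub>R Quot P\<^esub>" using h_pow[of n] n(2) by simp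
    show "finite ((+>) P ` U)" "(+>) P ` U \<subseteq> carrier (R Quot P)" using U h.hom_closed by auto
    fix B assume B: "subring B (R Quot P)" "(+>) P ` U \<subseteq> B"
    \<comment> \<open>Generation passes to the quotient because the preimage of \<open>B\<close> is
      a subring of \<open>R\<close> containing \<open>U\<close>.\<close>
    let ?C = "{x \<in> carrier R. P +> x \<in> B}"
    have "subring ?C R" using subringE[OF B(1)] by (intro subringI) auto
    then have C: "?C = carrier R"
      by (rule U(3)) (use B(2) U(2) in \<open>simp add: image_subset_iff subset_iff\<close>)
    have "P +> x \<in> B" if "x \<in> carrier R" for x
    proof -
      have "x \<in> ?C" unfolding C by (rule that)
      then show ?thesis by simp
    qed
    then have "carrier (R Quot P) \<subseteq> B" unfolding surj by (rule image_subsetI)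
    then show "B = carrier (R Quot P)" using subringE(1)[OF B(1)] by (rule equalityI[rotated])
  qed
  moreover have hu: "P +> u \<in> Units (R Quot P)"
  proof -
    have "(P +> u) \<otimes>\<^bsub>R Quot P\<^esub> (P +> inv u) = \<one>\<^bsub>R Quot P\<^esub>"
      using h.hom_mult[of u "inv u"] u by simp
    moreover have "P +> u \<in> carrier (R Quot P)" "P +> inv u \<in> carrier (R Quot P)"
      using u h.hom_closed by auto
    ultimately show ?thesis using F.UnitsI_right_inverse by blast
  qed
  ultimately have fin: "finite (Units (R Quot P))" by blast
  \<comment> \<open>The order of the finite unit group of the residue field is an exponent for the
    image of \<open>u\<close>, so it puts a forbidden \<open>u^k - 1\<close> into
    \<open>P\<close>.\<close>
  define k where "k = card (Units (R Quot P))"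
  have "0 < k" unfolding k_def using fin hu card_gt_0_iff by blast
  have "(P +> u) [^]\<^bsub>R Quot P\<^esub> k = \<one>\<^bsub>R Quot P\<^esub>"
    unfolding k_def by (rule F.units_power_order_eq_one[OF fin hu])
  then have "P +> (u [^] k \<ominus> \<one>) = \<zero>\<^bsub>R Quot P\<^esub>"
    by (simp add: minus_eq h.hom_nat_pow F.r_neg)
  then have "u [^] k \<ominus> \<one> \<in> P"
    unfolding FactRing_zero using P.rcos_const_imp_mem[of "u [^] k \<ominus> \<one>"] by simp
  with \<open>0 < k\<close> P(2) show False by blast
qed

text \<open>In dimension zero all units are torsion, so the image of \<open>G\<close>, a finitely
  generated abelian group, is finite. Conversely a finite image generates \<open>S\<close>
  additively by finitely many elements killed by \<open>n\<close>, so \<open>S\<close> is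
  finite.\<close>

lemma krull_dim_eq_zero_iff_finite_image:
  fixes S (structure)
  assumes "cring S" and n: "0 < (n::nat)" "[n] \<cdot> \<one> = \<zero>"
    and "group G" and fg: "finitely_generated_group G"
    and \<phi>: "\<phi> \<in> hom G (units_of S)"
    and gen: "generate (add_monoid S) (\<phi> ` carrier G) = carrier S"
  shows "krull_dim S = 0 \<longleftrightarrow> \<one> \<noteq> \<zero> \<and> finite (\<phi> ` carrier G)"
proof -
  interpret S: cring S by fact
  interpret V: comm_group "units_of S" by (rule S.units_comm_group)
  interpret \<phi>: group_hom G "units_of S" \<phi>
    by (intro group_hom.intro group_hom_axioms.intro \<open>group G\<close> V.is_group \<phi>)
  have \<phi>_unit: "\<phi> g \<in> Units S" if "g \<in> carrier G" for g
    using \<phi>.hom_closed[OF that] by (simp add: units_of_carrier)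
  then have \<phi>_closed: "\<phi> ` carrier G \<subseteq> carrier S" by blast
  show ?thesis
  proof
    assume dim: "krull_dim S = 0"
    obtain T where T: "finite T" "T \<subseteq> carrier G" "generate G T = carrier G"
      using fg by (auto simp: finitely_generated_group_def)
    have inv_T: "(\<lambda>t. inv\<^bsub>G\<^esub> t) ` T \<subseteq> carrier G" using T by auto
    have ord: "\<exists>k::nat. 0 < k \<and> u [^] k = \<one>" if "u \<in> Units S" for u
    proof (rule S.Units_finite_order[OF dim n _ _ _ that])
      \<comment> \<open>Inverses of the generators are included because a subring need not be closed
        under inverses of units.\<close>
      let ?U = "\<phi> ` (T \<union> (\<lambda>t. inv\<^bsub>G\<^esub> t) ` T)"
      show "finite ?U" using T by simp
      have "T \<union> (\<lambda>t. inv\<^bsub>G\<^esub> t) ` T \<subseteq> carrier G" using T inv_T by blast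
      then show "?U \<subseteq> carrier S" using \<phi>_closed by blast
      fix B assume B: "subring B S" "?U \<subseteq> B"
      have "\<phi> g \<in> B" if "g \<in> generate G T" for g
        using that
      proof induction
        case one
        then show ?case using \<phi>.hom_one subringE(3)[OF B(1)] by (simp add: units_of_one)
      next
        case (eng g h)
        then have "g \<in> carrier G" "h \<in> carrier G" using T by auto
        then show ?case using eng subringE(6)[OF B(1)] \<phi>.hom_mult by (simp add: units_of_mult)
      qed (use B in auto)
      then have "generate (add_monoid S) (\<phi> ` carrier G) \<subseteq> B"
        using T B(1) by (intro S.add.generate_subgroup_incl) (auto simp: subring_def)
      then show "B = carrier S" using gen subringE(1)[OF B(1)] by auto
    qed
    have "finite (generate (units_of S) (\<phi> ` T))"
    proof (rule V.finite_generate)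
      fix s assume "s \<in> \<phi> ` T"
      then have "s \<in> Units S" using T \<phi>_unit by auto
      then show "\<exists>k::nat. 0 < k \<and> s [^]\<^bsub>units_of S\<^esub> k = \<one>\<^bsub>units_of S\<^esub>"
        using ord by (simp add: S.units_of_pow units_of_one)
    qed (use T \<phi>_unit in \<open>auto simp: units_of_carrier\<close>)
    then have "finite (\<phi> ` carrier G)" using \<phi>.generate_img[OF T(2)] T(3) by simp
    then show "\<one> \<noteq> \<zero> \<and> finite (\<phi> ` carrier G)" using dim krull_dim_eq_zero_iff[OF S.is_cring] by blast
  next
    assume *: "\<one> \<noteq> \<zero> \<and> finite (\<phi> ` carrier G)"
    have "finite (generate (add_monoid S) (\<phi> ` carrier G))"
    proof (rule S.add.finite_generate)
      fix s assume "s \<in> \<phi> ` carrier G"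
      then have "[n] \<cdot> s = \<zero>" using \<phi>_closed S.add_pow_ldistr[of \<one> s n] n(2) by auto
      then show "\<exists>k::nat. 0 < k \<and> [k] \<cdot> s = \<zero>" using n(1) by blast
    qed (use * \<phi>_closed in auto)
    then show "krull_dim S = 0" using S.krull_dim_eq_zero_if_finite gen * by simp
  qed
qed

text \<open>The map \<open>h\<close> is constant on each coset of a subgroup of its kernel, so there
  are at most as many values as cosets.\<close>

lemma (in group_hom) finite_image_if_finite_rcosets:
  assumes \<Gamma>: "subgroup \<Gamma> G" "\<Gamma> \<subseteq> kernel G H h" and fin: "finite (rcosets \<Gamma>)"
  shows "finite (h ` carrier G)"
proof -
  have "finite (h ` C)" if C: "C \<in> rcosets \<Gamma>" for C
  proof -
    obtain g where g: "g \<in> carrier G" "C = \<Gamma> #> g" using C by (auto simp: RCOSETS_def)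
    have "h ` C \<subseteq> {h g}"
      using g \<Gamma> subgroup.subset[OF \<Gamma>(1)] by (auto simp: r_coset_def kernel_def)
    then show ?thesis by (rule finite_subset) simp
  qed
  then have "finite (\<Union>C\<in>rcosets \<Gamma>. h ` C)" using fin by blast
  then show ?thesis using G.rcosets_part_G[OF \<Gamma>(1)] by (simp flip: image_Union)
qed

text \<open>The cosets of the kernel are the fibres of \<open>h\<close> over its image.\<close>

lemma (in group_hom) finite_rcosets_kernel:
  assumes "finite (h ` carrier G)"
  shows "finite (rcosets (kernel G H h))"
proof -
  have "kernel G H h #> g = {x \<in> carrier G. h x = h g}" if g: "g \<in> carrier G" for g
  proof -
    have "x \<in> kernel G H h #> g \<longleftrightarrow> x \<in> carrier G \<and> h x = h g" for x
    proof (cases "x \<in> carrier G")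
      case True
      have "x \<in> kernel G H h #> g \<longleftrightarrow> h x \<otimes>\<^bsub>H\<^esub> inv\<^bsub>H\<^esub> h g = \<one>\<^bsub>H\<^esub>"
        using subgroup.rcos_module[OF subgroup_kernel G.is_group g True] True g by (simp add: kernel_def)
      also have "\<dots> \<longleftrightarrow> h x = h g" using True g H.inv_solve_right'[of "\<one>\<^bsub>H\<^esub>" "h x" "h g"] by auto
      finally show ?thesis using True by simp
    next
      case False
      have "kernel G H h #> g \<subseteq> carrier G" using g by (auto simp: r_coset_def kernel_def)
      then show ?thesis using False by blast
    qed
    then show ?thesis by blast
  qed
  then have "rcosets (kernel G H h) \<subseteq> (\<lambda>y. {x \<in> carrier G. h x = y}) ` h ` carrier G"
    by (auto simp: RCOSETS_def)
  then show ?thesis using assms by (rule finite_subset[OF _ finite_imageI])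
qed

subsection \<open>Group rings\<close>

lemma group_ring_m_comm:
  assumes "cring K" "comm_group G" "f \<in> carrier (group_ring K G)" "h \<in> carrier (group_ring K G)"
  shows "f \<otimes>\<^bsub>group_ring K G\<^esub> h = h \<otimes>\<^bsub>group_ring K G\<^esub> f"
proof -
  interpret K: cring K by fact
  interpret G: comm_group G by fact
  have f: "f s \<in> carrier K" "f s \<noteq> \<zero>\<^bsub>K\<^esub> \<Longrightarrow> s \<in> carrier G"
    and h: "h s \<in> carrier K" "h s \<noteq> \<zero>\<^bsub>K\<^esub> \<Longrightarrow> s \<in> carrier G" for s
    using assms(3,4) by (auto simp: group_ring_def)
  have "finsum K (\<lambda>(s, t). f s \<otimes>\<^bsub>K\<^esub> h t) {(s, t). f s \<noteq> \<zero>\<^bsub>K\<^esub> \<and> h t \<noteq> \<zero>\<^bsub>K\<^esub> \<and> s \<otimes>\<^bsub>G\<^esub> t = g}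
      = finsum K (\<lambda>(s, t). h s \<otimes>\<^bsub>K\<^esub> f t) {(s, t). h s \<noteq> \<zero>\<^bsub>K\<^esub> \<and> f t \<noteq> \<zero>\<^bsub>K\<^esub> \<and> s \<otimes>\<^bsub>G\<^esub> t = g}"
    (is "finsum K ?F ?A = finsum K ?H ?B") for g
  proof -
    \<comment> \<open>Supports lie in the abelian group \<open>G\<close>, so swapping the factors
      matches the two index sets.\<close>
    have "?A = prod.swap ` ?B" using f h by (force simp: G.m_comm image_iff)
    moreover have "finsum K ?F (prod.swap ` ?B) = finsum K (\<lambda>x. ?F (prod.swap x)) ?B"
      by (rule K.finsum_reindex) (use f h in auto)
    ultimately have "finsum K ?F ?A = finsum K (\<lambda>x. ?F (prod.swap x)) ?B" by simp
    also have "\<dots> = finsum K ?H ?B" using f h by (auto intro!: K.finsum_cong' simp: K.m_comm)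
    finally show ?thesis .
  qed
  then show ?thesis by (simp add: group_ring_def)
qed

lemma group_ring_monom_closed:
  assumes "cring K" "g \<in> carrier G"
  shows "group_ring_monom K g \<in> carrier (group_ring K G)"
proof -
  interpret K: cring K by fact
  have "{x. group_ring_monom K g x \<noteq> \<zero>\<^bsub>K\<^esub>} \<subseteq> {g}" by (auto simp: group_ring_monom_def)
  then show ?thesis using assms(2) finite_subset[of _ "{g}"]
    by (auto simp: group_ring_def group_ring_monom_def)
qed

lemma group_ring_monom_mult:
  assumes "cring K"
  shows "group_ring_monom K g \<otimes>\<^bsub>group_ring K G\<^esub> group_ring_monom K h = group_ring_monom K (g \<otimes>\<^bsub>G\<^esub> h)"
proof
  fix x
  interpret K: cring K by fact
  let ?A = "{(s, t). group_ring_monom K g s \<noteq> \<zero>\<^bsub>K\<^esub> \<and> group_ring_monom K h t \<noteq> \<zero>\<^bsub>K\<^esub> \<and> s \<otimes>\<^bsub>G\<^esub> t = x}"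
  \<comment> \<open>If 1 = 0 in \<open>K\<close>, as happens for the integers modulo 1, all
    monomials are zero and the index set is empty.\<close>
  have A: "?A = (if \<one>\<^bsub>K\<^esub> \<noteq> \<zero>\<^bsub>K\<^esub> \<and> g \<otimes>\<^bsub>G\<^esub> h = x then {(g, h)} else {})"
    by (auto simp: group_ring_monom_def)
  have "(group_ring_monom K g \<otimes>\<^bsub>group_ring K G\<^esub> group_ring_monom K h) x
      = finsum K (\<lambda>(s, t). group_ring_monom K g s \<otimes>\<^bsub>K\<^esub> group_ring_monom K h t) ?A"
    by (simp add: group_ring_def)
  also have "\<dots> = group_ring_monom K (g \<otimes>\<^bsub>G\<^esub> h) x"
    unfolding A by (auto simp: group_ring_monom_def)
  finally show "(group_ring_monom K g \<otimes>\<^bsub>group_ring K G\<^esub> group_ring_monom K h) x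
      = group_ring_monom K (g \<otimes>\<^bsub>G\<^esub> h) x" .
qed

lemma group_ring_monom_one: "group_ring_monom K \<one>\<^bsub>G\<^esub> = \<one>\<^bsub>group_ring K G\<^esub>"
  by (simp add: group_ring_monom_def group_ring_def)

lemma group_ring_add: "(f \<oplus>\<^bsub>group_ring K G\<^esub> h) x = f x \<oplus>\<^bsub>K\<^esub> h x"
  by (simp add: group_ring_def)

lemma group_ring_add_pow:
  shows "add_pow (group_ring K G) (i::nat) f x = add_pow K i (f x)"
  by (induction i) (simp_all add: add_pow_def nat_pow_def group_ring_def)

text \<open>Every coefficient is a natural multiple of 1, so an element of the group ring is a sum
  of monomials with repetition. The induction removes one point of the support at a time.\<close>

lemma group_ring_additively_generated:
  assumes "cring K"
    and K: "\<And>c. c \<in> carrier K \<Longrightarrow> \<exists>i::nat. c = [i] \<cdot>\<^bsub>K\<^esub> \<one>\<^bsub>K\<^esub>"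
    and R: "ring (group_ring K G)"
    and B: "subgroup B (add_monoid (group_ring K G))" "group_ring_monom K ` carrier G \<subseteq> B"
  shows "carrier (group_ring K G) \<subseteq> B"
proof
  interpret K: cring K by fact
  let ?R = "group_ring K G"
  interpret R: ring ?R by fact
  fix f assume f: "f \<in> carrier ?R"
  then have "finite {x. f x \<noteq> \<zero>\<^bsub>K\<^esub>}" by (simp add: group_ring_def)
  then show "f \<in> B" using f
  proof (induction "{x. f x \<noteq> \<zero>\<^bsub>K\<^esub>}" arbitrary: f rule: finite_induct)
    case empty
    then have "f = \<zero>\<^bsub>?R\<^esub>" by (auto simp: group_ring_def)
    then show ?case using subgroup.one_closed[OF B(1)] by simp
  next
    case (insert g A)
    have g: "f g \<noteq> \<zero>\<^bsub>K\<^esub>" "g \<in> carrier G" "f g \<in> carrier K" "range f \<subseteq> carrier K"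
      using insert.hyps(4) insert.prems by (auto simp: group_ring_def)
    define f' where "f' = f(g := \<zero>\<^bsub>K\<^esub>)"
    have supp: "A = {x. f' x \<noteq> \<zero>\<^bsub>K\<^esub>}" using insert.hyps(2,4) by (auto simp: f'_def)
    have "range f' \<subseteq> carrier K" "A \<subseteq> carrier G"
      using g insert.hyps(4) insert.prems by (auto simp: f'_def group_ring_def)
    then have "f' \<in> carrier ?R"
      using insert.hyps(1) unfolding group_ring_def by (simp add: supp[symmetric])
    then have "f' \<in> B" by (rule insert.hyps(3)[OF supp])
    obtain i :: nat where i: "f g = [i] \<cdot>\<^bsub>K\<^esub> \<one>\<^bsub>K\<^esub>" using K g by blast
    have "[i] \<cdot>\<^bsub>?R\<^esub> group_ring_monom K g \<in> B"
      using B g by (induction i) (auto simp: subgroup.one_closed[OF B(1), simplified]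
          intro!: subgroup.m_closed[OF B(1), simplified])
    moreover have "f = f' \<oplus>\<^bsub>?R\<^esub> [i] \<cdot>\<^bsub>?R\<^esub> group_ring_monom K g"
    proof
      fix x
      have "(f' \<oplus>\<^bsub>?R\<^esub> [i] \<cdot>\<^bsub>?R\<^esub> group_ring_monom K g) x = f' x \<oplus>\<^bsub>K\<^esub> [i] \<cdot>\<^bsub>K\<^esub> group_ring_monom K g x"
        by (simp add: group_ring_add group_ring_add_pow)
      then show "f x = (f' \<oplus>\<^bsub>?R\<^esub> [i] \<cdot>\<^bsub>?R\<^esub> group_ring_monom K g) x"
        using g i by (auto simp: f'_def group_ring_monom_def subset_iff)
    qed
    ultimately show ?case using \<open>f' \<in> B\<close> subgroup.m_closed[OF B(1)] by simp
  qed
qed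

text \<open>Reading multiples of 1 as residue classes gives both facts needed about the
  coefficients: 1 generates them additively, and \<open>[n]\<close> kills 1.\<close>

lemma ZFact_add_pow_one: "[(i::nat)] \<cdot>\<^bsub>ZFact m\<^esub> \<one>\<^bsub>ZFact m\<^esub> = ZMod m (int i)"
proof -
  interpret I: ideal "Idl\<^bsub>\<Z>\<^esub> {m}" \<Z> by (rule int.genideal_ideal) simp
  interpret K: cring "ZFact m" by (rule ZFact_is_cring)
  interpret h: ring_hom_ring \<Z> "ZFact m" "ZMod m"
    using I.rcos_ring_hom_ring by (simp add: ZFact_def ZMod_def[abs_def])
  have "\<one>\<^bsub>ZFact m\<^esub> = ZMod m 1" and zero: "\<zero>\<^bsub>ZFact m\<^esub> = ZMod m 0"
    using h.hom_one h.hom_zero by simp_all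
  moreover have "ZMod m (a + b) = ZMod m a \<oplus>\<^bsub>ZFact m\<^esub> ZMod m b" for a b
    using h.hom_add[of a b] by simp
  ultimately have step: "ZMod m (int (Suc i)) = ZMod m (int i) \<oplus>\<^bsub>ZFact m\<^esub> \<one>\<^bsub>ZFact m\<^esub>" for i
    by (metis of_nat_Suc add.commute)
  show ?thesis
  proof (induction i)
    case 0
    show ?case using zero by simp
  next
    case (Suc i)
    then show ?case unfolding step by simp
  qed
qed

lemma ZFact_carrier: "carrier (ZFact m) = range (ZMod m)"
  unfolding ZFact_def ZMod_def FactRing_def A_RCOSETS_def' by auto

theorem proposition36:
  fixes n :: nat
    and \<Lambda> :: "('g, 'b) monoid_scheme"
    and \<aa> :: "('g \<Rightarrow> int set) set"
  defines "R \<equiv> group_ring (ZFact (int n)) \<Lambda>"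
  assumes "n > 0"
    and "comm_group \<Lambda>"
    and "finitely_generated_group \<Lambda>"
    and "ideal \<aa> R"
  shows "krull_dim (R Quot \<aa>) = 0 \<longleftrightarrow>
    \<aa> \<noteq> carrier R \<and>
    (\<exists>\<Gamma>. subgroup \<Gamma> \<Lambda> \<and> finite (rcosets\<^bsub>\<Lambda>\<^esub> \<Gamma>) \<and>
      (\<forall>\<gamma>\<in>\<Gamma>. group_ring_monom (ZFact (int n)) \<gamma> \<ominus>\<^bsub>R\<^esub> \<one>\<^bsub>R\<^esub> \<in> \<aa>))"
proof -
  let ?K = "ZFact (int n)"
  let ?x = "group_ring_monom ?K"
  let ?S = "R Quot \<aa>"
  interpret \<Lambda>: comm_group \<Lambda> by fact
  interpret K: cring ?K by (rule ZFact_is_cring)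
  interpret \<aa>: ideal \<aa> R by fact
  \<comment> \<open>The assumption \<open>ideal \<aa> R\<close> carries the ring axioms of
    \<open>R\<close>, so only commutativity remains.\<close>
  have "cring R"
    using group_ring_m_comm[OF K.is_cring \<open>comm_group \<Lambda>\<close>]
    by (intro cring.intro \<aa>.ring_axioms \<aa>.monoid_comm_monoidI) (simp add: R_def)
  interpret R: cring R by fact
  interpret S: cring ?S by (rule \<aa>.quotient_is_cring[OF \<open>cring R\<close>])
  interpret h: ring_hom_ring R ?S "(+>\<^bsub>R\<^esub>) \<aa>" by (rule \<aa>.rcos_ring_hom_ring)
  define \<phi> where "\<phi> g = \<aa> +>\<^bsub>R\<^esub> ?x g" for g
  have mem_\<aa>: "\<aa> +>\<^bsub>R\<^esub> y = \<zero>\<^bsub>?S\<^esub> \<longleftrightarrow> y \<in> \<aa>" if "y \<in> carrier R" for y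
  proof -
    show ?thesis
      unfolding FactRing_zero using \<aa>.rcos_const_imp_mem[OF that] \<aa>.a_rcos_const by blast
  qed
  have x_closed: "?x g \<in> carrier R" if "g \<in> carrier \<Lambda>" for g
    unfolding R_def by (rule group_ring_monom_closed[OF K.is_cring that])
  have \<phi>_mult: "\<phi> (g \<otimes>\<^bsub>\<Lambda>\<^esub> g') = \<phi> g \<otimes>\<^bsub>?S\<^esub> \<phi> g'" if "g \<in> carrier \<Lambda>" "g' \<in> carrier \<Lambda>" for g g'
    unfolding \<phi>_def using h.hom_mult[OF x_closed[OF that(1)] x_closed[OF that(2)]]
    by (simp add: R_def group_ring_monom_mult[OF K.is_cring])
  have \<phi>_one: "\<phi> \<one>\<^bsub>\<Lambda>\<^esub> = \<one>\<^bsub>?S\<^esub>"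
    using h.hom_one by (simp add: \<phi>_def R_def group_ring_monom_one)
  have \<phi>_closed: "\<phi> g \<in> carrier ?S" if "g \<in> carrier \<Lambda>" for g
    unfolding \<phi>_def using x_closed[OF that] by simp
  have \<phi>_unit: "\<phi> g \<in> Units ?S" if g: "g \<in> carrier \<Lambda>" for g
  proof -
    have "\<phi> g \<otimes>\<^bsub>?S\<^esub> \<phi> (inv\<^bsub>\<Lambda>\<^esub> g) = \<one>\<^bsub>?S\<^esub>"
      using \<phi>_mult[of g "inv\<^bsub>\<Lambda>\<^esub> g"] \<phi>_one g by simp
    moreover have "\<phi> g \<in> carrier ?S" "\<phi> (inv\<^bsub>\<Lambda>\<^esub> g) \<in> carrier ?S" using g by (auto intro: \<phi>_closed)
    ultimately show ?thesis using S.UnitsI_right_inverse by blast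
  qed
  have \<phi>_hom: "\<phi> \<in> hom \<Lambda> (units_of ?S)"
    using \<phi>_unit \<phi>_mult by (auto simp: hom_def units_of_carrier units_of_mult)
  interpret \<phi>: group_hom \<Lambda> "units_of ?S" \<phi>
    by (intro group_hom.intro group_hom_axioms.intro \<Lambda>.is_group S.units_group \<phi>_hom)
  have kernel: "g \<in> kernel \<Lambda> (units_of ?S) \<phi> \<longleftrightarrow> g \<in> carrier \<Lambda> \<and> ?x g \<ominus>\<^bsub>R\<^esub> \<one>\<^bsub>R\<^esub> \<in> \<aa>" for g
  proof (cases "g \<in> carrier \<Lambda>")
    case True
    have "?x g \<ominus>\<^bsub>R\<^esub> \<one>\<^bsub>R\<^esub> \<in> \<aa> \<longleftrightarrow> \<phi> g \<ominus>\<^bsub>?S\<^esub> \<one>\<^bsub>?S\<^esub> = \<zero>\<^bsub>?S\<^esub>"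
      using mem_\<aa>[of "?x g \<ominus>\<^bsub>R\<^esub> \<one>\<^bsub>R\<^esub>"] x_closed[OF True] by (simp add: \<phi>_def a_minus_def)
    also have "\<dots> \<longleftrightarrow> \<phi> g = \<one>\<^bsub>?S\<^esub>" using \<phi>_closed[OF True] by simp
    finally show ?thesis using True by (simp add: kernel_def units_of_one)
  qed (simp add: kernel_def)
  have K_gen: "\<exists>i::nat. c = [i] \<cdot>\<^bsub>?K\<^esub> \<one>\<^bsub>?K\<^esub>" if "c \<in> carrier ?K" for c
  proof -
    obtain a where "c = ZMod (int n) a" using \<open>c \<in> carrier ?K\<close> unfolding ZFact_carrier by auto
    \<comment> \<open>As \<open>n\<close> is positive, \<open>a mod int n\<close> is a nonnegative
      representative, so \<open>nat\<close> does not alter it.\<close>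
    then have "c = ZMod (int n) (int (nat (a mod int n)))"
      using ZMod_mod[of "int n" a] \<open>n > 0\<close> by simp
    then show ?thesis unfolding ZFact_add_pow_one by blast
  qed
  have "[n] \<cdot>\<^bsub>?K\<^esub> \<one>\<^bsub>?K\<^esub> = [(0::nat)] \<cdot>\<^bsub>?K\<^esub> \<one>\<^bsub>?K\<^esub>"
    unfolding ZFact_add_pow_one ZMod_eq_mod by simp
  then have "[n] \<cdot>\<^bsub>R\<^esub> \<one>\<^bsub>R\<^esub> = \<zero>\<^bsub>R\<^esub>"
    unfolding R_def by (intro ext) (simp add: group_ring_add_pow, simp add: group_ring_def)
  moreover have "\<aa> +>\<^bsub>R\<^esub> ([i] \<cdot>\<^bsub>R\<^esub> \<one>\<^bsub>R\<^esub>) = [i] \<cdot>\<^bsub>?S\<^esub> \<one>\<^bsub>?S\<^esub>" for i :: nat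
    by (induction i) auto
  ultimately have S_n: "[n] \<cdot>\<^bsub>?S\<^esub> \<one>\<^bsub>?S\<^esub> = \<zero>\<^bsub>?S\<^esub>" by (metis h.hom_zero)
  let ?A = "generate (add_monoid ?S) (\<phi> ` carrier \<Lambda>)"
  have A: "subgroup ?A (add_monoid ?S)" using \<phi>_closed by (intro S.add.generate_is_subgroup) auto
  have "?A = carrier ?S"
  proof
    show "?A \<subseteq> carrier ?S" using subgroup.subset[OF A] by simp
    have A_neg: "\<ominus>\<^bsub>?S\<^esub> y \<in> ?A" if "y \<in> ?A" for y
      unfolding a_inv_def by (rule subgroup.m_inv_closed[OF A that])
    \<comment> \<open>The preimage of \<open>?A\<close> is an additive subgroup containing all
      monomials, hence all of \<open>R\<close>.\<close>
    let ?B = "{y \<in> carrier R. \<aa> +>\<^bsub>R\<^esub> y \<in> ?A}"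
    have "subgroup ?B (add_monoid R)"
      using subgroup.one_closed[OF A] subgroup.m_closed[OF A] A_neg
      by (intro \<aa>.add.subgroupI) auto
    moreover have "?x ` carrier \<Lambda> \<subseteq> ?B" using x_closed by (auto simp: \<phi>_def intro: generate.incl)
    ultimately have "carrier R \<subseteq> ?B"
      using group_ring_additively_generated[OF K.is_cring K_gen] \<aa>.ring_axioms
      unfolding R_def by blast
    then show "carrier ?S \<subseteq> ?A" by (auto simp: FactRing_carrier)
  qed
  then have "krull_dim ?S = 0 \<longleftrightarrow> \<one>\<^bsub>?S\<^esub> \<noteq> \<zero>\<^bsub>?S\<^esub> \<and> finite (\<phi> ` carrier \<Lambda>)"
    by (rule krull_dim_eq_zero_iff_finite_image[OF S.is_cring \<open>n > 0\<close> S_n \<Lambda>.is_group assms(4) \<phi>_hom])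
  \<comment> \<open>Properness of \<aa> excludes the zero quotient, which has dimension minus
    infinity although \<Gamma> = \<Lambda> satisfies the subgroup condition there.\<close>
  also have "\<one>\<^bsub>?S\<^esub> \<noteq> \<zero>\<^bsub>?S\<^esub> \<longleftrightarrow> \<aa> \<noteq> carrier R"
    using mem_\<aa>[of "\<one>\<^bsub>R\<^esub>"] \<aa>.one_imp_carrier h.hom_one by auto
  also have "finite (\<phi> ` carrier \<Lambda>) \<longleftrightarrow>
    (\<exists>\<Gamma>. subgroup \<Gamma> \<Lambda> \<and> finite (rcosets\<^bsub>\<Lambda>\<^esub> \<Gamma>) \<and> (\<forall>\<gamma>\<in>\<Gamma>. ?x \<gamma> \<ominus>\<^bsub>R\<^esub> \<one>\<^bsub>R\<^esub> \<in> \<aa>))"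
  proof
    assume "finite (\<phi> ` carrier \<Lambda>)"
    then show "\<exists>\<Gamma>. subgroup \<Gamma> \<Lambda> \<and> finite (rcosets\<^bsub>\<Lambda>\<^esub> \<Gamma>) \<and> (\<forall>\<gamma>\<in>\<Gamma>. ?x \<gamma> \<ominus>\<^bsub>R\<^esub> \<one>\<^bsub>R\<^esub> \<in> \<aa>)"
      \<comment> \<open>The witness for \<Gamma> is the kernel of \<open>\<phi>\<close>, the largest
        subgroup with the required congruences.\<close>
      using \<phi>.subgroup_kernel \<phi>.finite_rcosets_kernel kernel by blast
  next
    assume "\<exists>\<Gamma>. subgroup \<Gamma> \<Lambda> \<and> finite (rcosets\<^bsub>\<Lambda>\<^esub> \<Gamma>) \<and> (\<forall>\<gamma>\<in>\<Gamma>. ?x \<gamma> \<ominus>\<^bsub>R\<^esub> \<one>\<^bsub>R\<^esub> \<in> \<aa>)"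
    then obtain \<Gamma> where \<Gamma>: "subgroup \<Gamma> \<Lambda>" "finite (rcosets\<^bsub>\<Lambda>\<^esub> \<Gamma>)"
      "\<forall>\<gamma>\<in>\<Gamma>. ?x \<gamma> \<ominus>\<^bsub>R\<^esub> \<one>\<^bsub>R\<^esub> \<in> \<aa>" by blast
    then have "\<Gamma> \<subseteq> kernel \<Lambda> (units_of ?S) \<phi>" using subgroup.subset[OF \<Gamma>(1)] kernel by blast
    then show "finite (\<phi> ` carrier \<Lambda>)" using \<phi>.finite_image_if_finite_rcosets \<Gamma> by blast
  qed
  finally show ?thesis .
qed

end
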